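(* Let $Y=Y_1+\dots+Y_n$, where $Y_1,\dots,Y_n$ are independent zero-mean random variables such that, for some positive real numbers $\sigma_1,\dots,\sigma_n$, $$\mathsf{E}e^{\lambda Y_i}\le e^{\lambda^2\sigma_i^2/2}\quad\text{for all } i\in\{1,\dots,n\}\text{ and all real }\lambda\ge0 .$$ Let $\sigma:=\sqrt{\sigma_1^2+\dots+\sigma_n^2}$. Then for all real $y>0$, $$\mathsf{P}(Y\ge y)\le\inf_{\lambda>0}p_{\mu_\lambda,v_y(\lambda)},$$ where $\mu_\lambda:=e^{\lambda^2\sigma^2/2}$ and $v_y(\lambda):=e^{\lambda y}$.
   Context: For real $\mu>1$ and $v\in(\mu,\infty)$, $z_{\mu,v}$ denotes the only root $z\in(0,1)$ of the equation $(v-\mu)\ln z+(\mu-z)\ln v=0$ (there is exactly one such root), and $p_{\mu,v}:=\dfrac{\mu-z_{\mu,v}}{v-z_{\mu,v}}$. For $v\in[1,\mu]$, by convention $p_{\mu,v}:=1$. $\mathsf{P}$ and $\mathsf{E}$ denote probability and expectation. *)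

theory Defs
  imports "HOL-Probability.Probability"
begin

definition z_root :: "real \<Rightarrow> real \<Rightarrow> real" where
  "z_root \<mu> v = (THE z. 0 < z \<and> z < 1 \<and> (v - \<mu>) * ln z + (\<mu> - z) * ln v = 0)"

lemma z_root_ex1:
  fixes \<mu> v :: real
  assumes "1 < \<mu>" "\<mu> < v"
  shows "\<exists>!z. 0 < z \<and> z < 1 \<and> (v - \<mu>) * ln z + (\<mu> - z) * ln v = 0"
proof -
  define h where "h z = (v - \<mu>) * ln z + (\<mu> - z) * ln v" for z
  have h_deriv: "(h has_real_derivative (v - \<mu>) / z - ln v) (at z)" if "0 < z" for z
    unfolding h_def using that by (auto intro!: derivative_eq_intros simp: field_simps)
  have h_v: "h v = 0"
    by (simp add: h_def algebra_simps)
  have h_1: "0 < h 1"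
    using assms by (simp add: h_def)
  text \<open>\<open>h\<close> has a zero at \<open>v > 1\<close>, so two zeros below 1 would give two zeros of its injective derivative.\<close>
  have False if ab: "0 < a" "a < b" "b < 1" "h a = 0" "h b = 0" for a b
  proof -
    have rolle: "\<exists>c>x. c < w \<and> (v - \<mu>) / c - ln v = 0"
      if "0 < x" "x < w" "h x = 0" "h w = 0" for x w
    proof -
      have "\<exists>c>x. c < w \<and> h w - h x = (w - x) * ((v - \<mu>) / c - ln v)"
        using that by (intro MVT2 h_deriv) linarith+
      then obtain c where "x < c" "c < w" "h w - h x = (w - x) * ((v - \<mu>) / c - ln v)"
        by blast
      moreover from this have "(v - \<mu>) / c - ln v = 0"
        using that by simp
      ultimately show ?thesis by blast
    qed
    obtain c where c: "a < c" "c < b" "(v - \<mu>) / c - ln v = 0"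
      using rolle[of a b] ab by blast
    have "b < v" "0 < b"
      using ab assms by linarith+
    then obtain d where d: "b < d" "d < v" "(v - \<mu>) / d - ln v = 0"
      using rolle[of b v] ab h_v by blast
    have "(v - \<mu>) / d < (v - \<mu>) / c"
      using c d ab assms by (intro divide_strict_left_mono mult_pos_pos) linarith+
    with c(3) d(3) show False by linarith
  qed
  moreover have "\<exists>z. 0 < z \<and> z < 1 \<and> h z = 0"
  proof -
    define a where "a = exp (- (\<mu> * ln v / (v - \<mu>)))"
    have a: "0 < a" "a < 1" and "(v - \<mu>) * ln a = - (\<mu> * ln v)"
      using assms by (simp_all add: a_def)
    hence "h a = - (a * ln v)"
      by (simp add: h_def algebra_simps)
    hence "h a < 0"
      using a assms by simp
    moreover have "continuous_on {a..1} h"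
      unfolding h_def using a(1) by (intro continuous_intros) auto
    ultimately obtain z where z: "a \<le> z" "z \<le> 1" "h z = 0"
      using IVT'[of h a 0 1] a(2) h_1 by fastforce
    hence "z \<noteq> 1"
      using h_1 by auto
    hence "0 < z \<and> z < 1 \<and> h z = 0"
      using a(1) z by linarith
    thus ?thesis ..
  qed
  ultimately show ?thesis
    unfolding h_def[symmetric] by (meson linorder_less_linear)
qed

text \<open>Meaningful for \<open>1 < \<mu>\<close> and \<open>1 \<le> v\<close> only; other arguments give junk values.\<close>

definition p_bound :: "real \<Rightarrow> real \<Rightarrow> real" where
  "p_bound \<mu> v = (if v \<in> {1..\<mu>} then 1 else (\<mu> - z_root \<mu> v) / (v - z_root \<mu> v))"

end

(* Put X = exp (l Y), so that E X <= mu and E (ln X) = 0, and let z = z_root mu v.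
   The convex function g x = x - z - z ln (x / z) has minimum g z = 0 and dominates
   g v on [v, infinity), hence P (X >= v) <= E (g X) / g v.  The equation defining z
   says exactly that the resulting bound (mu - z + z ln z) / g v equals (mu - z) / (v - z). *)

theory Submission imports Defs begin

text \<open>The ratio on the right is the one that Markov's inequality produces: its denominator is
  \<open>g v\<close> for the function \<open>g\<close> of the next lemma, and its numerator bounds
  the expectation of \<open>g X\<close>.\<close>

lemma p_bound_eq_entropy_ratio:
  fixes \<mu> v :: real
  assumes "1 < \<mu>" "\<mu> < v"
  obtains z where "0 < z" "z < 1" "0 < v - z - z * ln (v / z)"
    and "p_bound \<mu> v = (\<mu> - z + z * ln z) / (v - z - z * ln (v / z))"
proof -
  define z where "z = z_root \<mu> v"
  have z: "0 < z" "z < 1" "(v - \<mu>) * ln z + (\<mu> - z) * ln v = 0"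
    using theI'[OF z_root_ex1[OF assms]] unfolding z_def z_root_def by blast+
  \<comment> \<open>Strict because \<open>v / z > 1\<close>, while \<open>ln t = t - 1\<close> holds
    only at \<open>t = 1\<close>.\<close>
  have "ln (v / z) < v / z - 1"
    using ln_le_minus_one[of "v / z"] ln_eq_minus_one[of "v / z"] z assms by fastforce
  hence "z * ln (v / z) < v - z"
    using mult_strict_left_mono[of "ln (v / z)" "v / z - 1" z] z by (simp add: algebra_simps)
  hence D: "0 < v - z - z * ln (v / z)" by simp
  have ln_quot: "ln (v / z) = ln v - ln z"
    using z assms by (simp add: ln_div)
  \<comment> \<open>A polynomial identity with \<open>ln v\<close> and \<open>ln z\<close> as free
    variables; its right side is a multiple of the equation that \<open>z\<close> solves.\<close>
  have "(\<mu> - z) * (v - z - z * ln (v / z)) - (\<mu> - z + z * ln z) * (v - z)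
      = - z * ((v - \<mu>) * ln z + (\<mu> - z) * ln v)"
    unfolding ln_quot by algebra
  hence "(\<mu> - z) * (v - z - z * ln (v / z)) = (\<mu> - z + z * ln z) * (v - z)"
    using z(3) by simp
  hence "(\<mu> - z) / (v - z) = (\<mu> - z + z * ln z) / (v - z - z * ln (v / z))"
    using D z assms by (subst frac_eq_eq) auto
  moreover have "p_bound \<mu> v = (\<mu> - z) / (v - z)"
    using assms by (simp add: p_bound_def z_def)
  ultimately show thesis
    using that z D by simp
qed

text \<open>One-sided bounds on the two expectations suffice: in \<open>g\<close>, the term
  \<open>x\<close> has coefficient 1 and \<open>ln x\<close> has the negative coefficient
  \<open>- z\<close>.\<close>

lemma (in prob_space) prob_ge_le_p_bound:
  fixes X :: "'a \<Rightarrow> real"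
  assumes pos: "\<And>\<omega>. \<omega> \<in> space M \<Longrightarrow> 0 < X \<omega>"
    and int: "integrable M X" "integrable M (\<lambda>\<omega>. ln (X \<omega>))"
    and mean: "expectation X \<le> \<mu>" and ln_mean: "0 \<le> expectation (\<lambda>\<omega>. ln (X \<omega>))"
    and "1 < \<mu>" "1 \<le> v"
  shows "prob {\<omega> \<in> space M. v \<le> X \<omega>} \<le> p_bound \<mu> v"
proof (cases "v \<le> \<mu>")
  case True
  thus ?thesis using \<open>1 \<le> v\<close> by (simp add: p_bound_def)
next
  case False
  then obtain z where z: "0 < z" "z < 1" and D: "0 < v - z - z * ln (v / z)"
    and p: "p_bound \<mu> v = (\<mu> - z + z * ln z) / (v - z - z * ln (v / z))"
    using p_bound_eq_entropy_ratio[of \<mu> v] \<open>1 < \<mu>\<close> by auto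
  \<comment> \<open>Expanded so that the expectation is linear in \<open>X\<close> and
    \<open>ln X\<close>; \<open>g_eq\<close> restores the form that shows the minimum at
    \<open>z\<close>.\<close>
  define g where "g x = x - z + z * ln z - z * ln x" for x
  have g_eq: "g x = x - z - z * ln (x / z)" if "0 < x" for x
    using that z by (simp add: g_def ln_div algebra_simps)
  have g_nonneg: "0 \<le> g x" if "0 < x" for x
  proof -
    have "z * ln (x / z) \<le> z * (x / z - 1)"
      using z that by (intro mult_left_mono ln_le_minus_one) auto
    thus ?thesis using z g_eq[OF that] by (simp add: algebra_simps)
  qed
  have g_mono: "g v \<le> g x" if "v \<le> x" for x
  proof -
    \<comment> \<open>The claim amounts to \<open>z * ln (x / v) \<le> x - v\<close>. Since
      \<open>z < 1 \<le> v\<close> and \<open>x / v - 1\<close> is nonnegative, the factor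
      \<open>z\<close> may be enlarged to \<open>v\<close>.\<close>
    have "ln (x / v) \<le> x / v - 1"
      using that \<open>1 \<le> v\<close> by (intro ln_le_minus_one) auto
    hence "z * ln (x / v) \<le> z * (x / v - 1)"
      using z by simp
    also have "\<dots> \<le> v * (x / v - 1)"
      using that z \<open>1 \<le> v\<close> by (intro mult_right_mono) (auto simp: field_simps)
    also have "\<dots> = x - v"
      using \<open>1 \<le> v\<close> by (simp add: field_simps)
    finally show ?thesis
      using that \<open>1 \<le> v\<close> by (simp add: g_def ln_div algebra_simps)
  qed
  have gv: "0 < g v" "g v = v - z - z * ln (v / z)"
    using D g_eq[of v] \<open>1 \<le> v\<close> by auto
  have int_g: "integrable M (\<lambda>\<omega>. g (X \<omega>))"
    unfolding g_def using int by auto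
  have "prob {\<omega> \<in> space M. v \<le> X \<omega>} \<le> prob {\<omega> \<in> space M. g v \<le> g (X \<omega>)}"
    using g_mono borel_measurable_integrable[OF int_g]
    by (intro finite_measure_mono) auto
  also have "\<dots> \<le> expectation (\<lambda>\<omega>. g (X \<omega>)) / g v"
    using int_g gv g_nonneg pos by (intro integral_Markov_inequality_measure[of _ _ "{}"]) auto
  also have "\<dots> \<le> (\<mu> - z + z * ln z) / g v"
  proof (intro divide_right_mono)
    have "expectation (\<lambda>\<omega>. g (X \<omega>))
        = expectation X - z + z * ln z - z * expectation (\<lambda>\<omega>. ln (X \<omega>))"
      unfolding g_def using int by (simp add: prob_space)
    moreover have "0 \<le> z * expectation (\<lambda>\<omega>. ln (X \<omega>))"
      using z ln_mean by simp
    ultimately show "expectation (\<lambda>\<omega>. g (X \<omega>)) \<le> \<mu> - z + z * ln z"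
      using mean by linarith
  qed (use gv in simp)
  finally show ?thesis
    using p gv by simp
qed

lemma (in prob_space) indep_vars_exp_sum:
  fixes Y :: "'i \<Rightarrow> 'a \<Rightarrow> real"
  assumes "finite I" and indep: "indep_vars (\<lambda>_. borel) Y I"
    and int: "\<And>i. i \<in> I \<Longrightarrow> integrable M (\<lambda>\<omega>. exp (l * Y i \<omega>))"
  shows "integrable M (\<lambda>\<omega>. exp (l * (\<Sum>i\<in>I. Y i \<omega>)))"
    and "expectation (\<lambda>\<omega>. exp (l * (\<Sum>i\<in>I. Y i \<omega>)))
      = (\<Prod>i\<in>I. expectation (\<lambda>\<omega>. exp (l * Y i \<omega>)))"
proof -
  have "indep_vars (\<lambda>_. borel) (\<lambda>i \<omega>. exp (l * Y i \<omega>)) I"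
    by (rule indep_vars_compose2[OF indep]) auto
  from indep_vars_integrable[OF \<open>finite I\<close> this int]
    indep_vars_lebesgue_integral[OF \<open>finite I\<close> this int]
  show "integrable M (\<lambda>\<omega>. exp (l * (\<Sum>i\<in>I. Y i \<omega>)))"
    and "expectation (\<lambda>\<omega>. exp (l * (\<Sum>i\<in>I. Y i \<omega>)))
      = (\<Prod>i\<in>I. expectation (\<lambda>\<omega>. exp (l * Y i \<omega>)))"
    using \<open>finite I\<close> by (simp_all add: sum_distrib_left exp_sum)
qed

theorem proposition3p2:
  fixes M :: "'a measure" and n :: nat and Y :: "nat \<Rightarrow> 'a \<Rightarrow> real"
    and \<sigma> :: "nat \<Rightarrow> real" and y :: real
  assumes "prob_space M"
    and "1 \<le> n"
    and "prob_space.indep_vars M (\<lambda>_. borel) Y {1..n}"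
    and "\<And>i. i \<in> {1..n} \<Longrightarrow> integrable M (Y i)"
    and "\<And>i. i \<in> {1..n} \<Longrightarrow> integral\<^sup>L M (Y i) = 0"
    and "\<And>i. i \<in> {1..n} \<Longrightarrow> 0 < \<sigma> i"
    and "\<And>i l. i \<in> {1..n} \<Longrightarrow> 0 \<le> l \<Longrightarrow>
      integrable M (\<lambda>\<omega>. exp (l * Y i \<omega>)) \<and>
      integral\<^sup>L M (\<lambda>\<omega>. exp (l * Y i \<omega>)) \<le> exp (l\<^sup>2 * (\<sigma> i)\<^sup>2 / 2)"
    and "0 < y"
  shows "measure M {\<omega> \<in> space M. y \<le> (\<Sum>i=1..n. Y i \<omega>)}
    \<le> (INF l\<in>{0<..}. p_bound (exp (l\<^sup>2 * (sqrt (\<Sum>i=1..n. (\<sigma> i)\<^sup>2))\<^sup>2 / 2)) (exp (l * y)))"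
proof (rule cINF_greatest)
  fix l :: real
  assume "l \<in> {0<..}"
  hence l: "0 < l" by simp
  interpret prob_space M by fact
  define S where "S = (\<Sum>i=1..n. (\<sigma> i)\<^sup>2)"
  \<comment> \<open>This makes \<open>exp (l\<^sup>2 * S / 2)\<close> exceed 1, as
    \<open>prob_ge_le_p_bound\<close> demands; \<open>1 \<le> n\<close> keeps the sum from being
    empty.\<close>
  have "0 < S"
    unfolding S_def using assms(2,6) by (intro sum_pos) force+
  define X where "X \<omega> = exp (l * (\<Sum>i=1..n. Y i \<omega>))" for \<omega>
  have int_exp: "integrable M (\<lambda>\<omega>. exp (l * Y i \<omega>))" if "i \<in> {1..n}" for i
    using assms(7)[OF that, of l] l by simp
  note X_moments = indep_vars_exp_sum[OF finite_atLeastAtMost assms(3) int_exp, folded X_def]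
  \<comment> \<open>As \<open>l > 0\<close>, this event is the original one.\<close>
  have "prob {\<omega> \<in> space M. exp (l * y) \<le> X \<omega>} \<le> p_bound (exp (l\<^sup>2 * S / 2)) (exp (l * y))"
  proof (rule prob_ge_le_p_bound)
    show "integrable M X"
      by (rule X_moments(1))
    show "integrable M (\<lambda>\<omega>. ln (X \<omega>))"
      unfolding X_def ln_exp using assms(4)
      by (intro integrable_mult_right Bochner_Integration.integrable_sum)
    have "expectation X = (\<Prod>i=1..n. expectation (\<lambda>\<omega>. exp (l * Y i \<omega>)))"
      by (rule X_moments(2))
    also have "\<dots> \<le> (\<Prod>i=1..n. exp (l\<^sup>2 * (\<sigma> i)\<^sup>2 / 2))"
      using assms(7) l by (intro prod_mono) auto
    also have "\<dots> = exp (l\<^sup>2 * S / 2)"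
      by (simp add: S_def exp_sum sum_distrib_left sum_divide_distrib)
    finally show "expectation X \<le> exp (l\<^sup>2 * S / 2)" .
    \<comment> \<open>Here \<open>ln X\<close> is \<open>l\<close> times the sum of the
      \<open>Y i\<close>, so the zero means give equality by linearity.\<close>
    show "0 \<le> expectation (\<lambda>\<omega>. ln (X \<omega>))"
      unfolding X_def ln_exp using assms(4,5) by (simp add: Bochner_Integration.integral_sum)
  qed (use l \<open>0 < S\<close> \<open>0 < y\<close> in \<open>auto simp: X_def\<close>)
  thus "prob {\<omega> \<in> space M. y \<le> (\<Sum>i=1..n. Y i \<omega>)}
      \<le> p_bound (exp (l\<^sup>2 * (sqrt (\<Sum>i=1..n. (\<sigma> i)\<^sup>2))\<^sup>2 / 2)) (exp (l * y))"
    using l \<open>0 < S\<close> by (simp add: X_def S_def)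
qed simp

end
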